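(* For all integers $k,n\geq 0$, the set $\mathcal{C}_{(k)}\cap\mathrm{DP}_n$ is $n$-opposite to itself.
   Context: Partitions are identified up to trailing zeros; $\ell(\gamma)$ is the number of nonzero parts, $|\gamma|$ the sum of parts; the diagram of $\gamma$ is $\{(i,j):1\leq i\leq\ell(\gamma),1\leq j\leq\gamma_i\}$. For a cell $c=(i,j)$, $\mathrm{arm}(c)=\gamma_i-j$, $\mathrm{leg}(c)=\gamma'_j-i$ ($\gamma'$ the conjugate). $\mathrm{dinv}(\gamma)$ is the number of cells with $\mathrm{arm}(c)-\mathrm{leg}(c)\in\{0,1\}$. $\gamma\in\mathrm{DP}_n$ (Dyck partition of order $n$) means the diagram of $\gamma$ is contained in that of $(n-1,n-2,\ldots,1,0)$; for such $\gamma$, $\mathrm{area}_n(\gamma)=\binom{n}{2}-|\gamma|$. Two subsets $B,C\subseteq\mathrm{DP}_n$ are $n$-opposite if there is a unique bijection $g:B\to C$ with $\mathrm{area}_n(\gamma)=\mathrm{dinv}(g(\gamma))$ and $\mathrm{dinv}(\gamma)=\mathrm{area}_n(g(\gamma))$ for all $\gamma\in B$ (with $B=C$ allowed). If $\gamma_1\leq\ell(\gamma)+2$, $\nu(\gamma)=(\ell(\gamma)+1,\gamma_1-1,\ldots,\gamma_{\ell(\gamma)}-1)$. For integers $j$ and $\ell>0$, $r_{j,\ell}=j-\ell\lfloor j/\ell\rfloor$. For $k\geq0,\ell>0$, $\mathbb{I}_{k,\ell}=(\underline{\ell}^{1+\lfloor k/\ell\rfloor},\ell-1,\ell-2,\ldots,1)+(\underline{0}^{1+\lfloor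 k/\ell\rfloor},\underline{1}^{r_{k,\ell}},\underline{0}^{\ell-1-r_{k,\ell}})$ (where $\underline{c}^d$ denotes $d$ copies of $c$ and sequences are added entrywise after padding with zeros), and $\mathbb{I}_{0,0}=(0)$. Define $\mathcal{C}_{(k)}=\bigcup_{\ell=\min(1,k)}^{\infty}\{\nu^m(\mathbb{I}_{k,\ell}):0\leq m\leq\ell\}$. *)

theory Defs
  imports Main "HOL-Library.FuncSet"
begin

text \<open>
  A partition, which is only considered up to trailing zeros, is represented by the list of its
  nonzero parts. Hence equality of lists is equality of partitions and \<^const>\<open>length\<close> is the number
  of nonzero parts.
\<close>

definition is_partition :: "nat list \<Rightarrow> bool" where
  "is_partition \<gamma> \<longleftrightarrow> sorted_wrt (\<ge>) \<gamma> \<and> 0 \<notin> set \<gamma>"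

text \<open>Parts are indexed from 1; parts beyond the length are 0.\<close>

definition part :: "nat list \<Rightarrow> nat \<Rightarrow> nat" where
  "part \<gamma> i = (if 1 \<le> i \<and> i \<le> length \<gamma> then \<gamma> ! (i - 1) else 0)"

definition conj_part :: "nat list \<Rightarrow> nat \<Rightarrow> nat" where
  "conj_part \<gamma> j = card {i. 1 \<le> i \<and> i \<le> length \<gamma> \<and> j \<le> part \<gamma> i}"

definition diagram :: "nat list \<Rightarrow> (nat \<times> nat) set" where
  "diagram \<gamma> = {(i, j). 1 \<le> i \<and> i \<le> length \<gamma> \<and> 1 \<le> j \<and> j \<le> part \<gamma> i}"

definition arm :: "nat list \<Rightarrow> nat \<times> nat \<Rightarrow> int" where
  "arm \<gamma> = (\<lambda>(i, j). int (part \<gamma> i) - int j)"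

definition leg :: "nat list \<Rightarrow> nat \<times> nat \<Rightarrow> int" where
  "leg \<gamma> = (\<lambda>(i, j). int (conj_part \<gamma> j) - int i)"

definition dinv :: "nat list \<Rightarrow> nat" where
  "dinv \<gamma> = card {c \<in> diagram \<gamma>. arm \<gamma> c - leg \<gamma> c \<in> {0, 1}}"

text \<open>\<^term>\<open>rev [1..<n]\<close> is the staircase \<open>(n-1, n-2, \<dots>, 1)\<close>.\<close>

definition DP :: "nat \<Rightarrow> nat list set" where
  "DP n = {\<gamma>. is_partition \<gamma> \<and> diagram \<gamma> \<subseteq> diagram (rev [1..<n])}"

definition area :: "nat \<Rightarrow> nat list \<Rightarrow> int" where
  "area n \<gamma> = int (n choose 2) - int (sum_list \<gamma>)"

text \<open>
  Restricting to \<^term>\<open>extensional B\<close> makes uniqueness of \<open>g\<close> refer to its values on \<open>B\<close> only.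
\<close>

definition opposite :: "nat \<Rightarrow> nat list set \<Rightarrow> nat list set \<Rightarrow> bool" where
  "opposite n B C \<longleftrightarrow> B \<subseteq> DP n \<and> C \<subseteq> DP n \<and>
     (\<exists>!g. g \<in> extensional B \<and> bij_betw g B C \<and>
        (\<forall>\<gamma>\<in>B. area n \<gamma> = int (dinv (g \<gamma>)) \<and> int (dinv \<gamma>) = area n (g \<gamma>)))"

text \<open>
  The filter drops the trailing zeros that arise from parts equal to 1.
\<close>

definition nu :: "nat list \<Rightarrow> nat list" where
  "nu \<gamma> = (if part \<gamma> 1 \<le> length \<gamma> + 2
     then filter (\<lambda>x. x > 0) ((length \<gamma> + 1) # map (\<lambda>x. x - 1) \<gamma>)
     else undefined)"

text \<open>
  For \<open>l > 0\<close> both summands have length \<open>k div l + l\<close>, so \<^const>\<open>map2\<close> truncates nothing, and the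
  result has no zero entries. The residue of \<open>k\<close> is \<^term>\<open>k mod l\<close>.
\<close>

definition II :: "nat \<Rightarrow> nat \<Rightarrow> nat list" where
  "II k l =
     (if l > 0 then
        map2 (+)
          (replicate (1 + k div l) l @ rev [1..<l])
          (replicate (1 + k div l) 0 @ replicate (k mod l) 1 @ replicate (l - 1 - k mod l) 0)
      else if k = 0 then []
      else undefined)"

definition CC :: "nat \<Rightarrow> nat list set" where
  "CC k = (\<Union>l\<in>{min 1 k..}. {(nu ^^ m) (II k l) |m. m \<le> l})"

end

theory Submission
  imports Defs
begin

text \<open>
  Write \<open>t\<^sub>l = l(l+1)/2\<close>. The map \<open>\<nu>\<close> raises both the size and \<open>dinv\<close> by 1, and \<open>I\<^sub>k\<^sub>,\<^sub>l\<close> has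
  size \<open>k + t\<^sub>l\<close> and \<open>dinv\<close> equal to \<open>t\<^sub>l\<close>; so \<open>dinv\<close> is injective on \<open>\<C>\<^sub>(\<^sub>k\<^sub>)\<close>, with \<open>|\<gamma>| = k + dinv \<gamma>\<close>,
  and a suitable bijection is unique if it exists. It remains to see that the set of \<open>dinv\<close> values
  on \<open>\<C>\<^sub>(\<^sub>k\<^sub>) \<inter> DP\<^sub>p\<^sub>+\<^sub>1\<close> is invariant under \<open>d \<mapsto> t\<^sub>p - k - d\<close>. Now \<open>\<nu>\<^sup>m(I\<^sub>k\<^sub>,\<^sub>l)\<close> lies in \<open>DP\<^sub>p\<^sub>+\<^sub>1\<close>
  iff \<open>l \<le> p\<close> and \<open>k + m \<le> l(p - l)\<close>. As \<open>t\<^sub>p = t\<^sub>l + t\<^sub>p\<^sub>-\<^sub>l + l(p - l)\<close>, this says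
  that \<open>d = t\<^sub>l + m\<close> satisfies \<open>t\<^sub>p\<^sub>-\<^sub>l \<le> t\<^sub>p - k - d\<close>. Hence \<open>d\<close> is attained iff some \<open>l \<le> p\<close> has
  \<open>t\<^sub>l \<le> d\<close> and \<open>t\<^sub>p\<^sub>-\<^sub>l \<le> t\<^sub>p - k - d\<close>, a condition symmetric under the reflection.
\<close>

section \<open>\<open>rim\<close>, and recursions for \<open>dinv\<close> by rows and by
  columns\<close>

text \<open>
  \<open>rim \<gamma> c\<close> counts the \<open>i \<ge> 1\<close> with \<open>\<gamma>\<^sub>i + i = c\<close>, where \<open>\<gamma>\<^sub>i = 0\<close> beyond the length. The same number
  is obtained from the conjugate partition, which eliminates legs from \<open>dinv\<close>.
\<close>

fun rim :: "nat list \<Rightarrow> nat \<Rightarrow> nat" where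
  "rim [] c = of_bool (0 < c)"
| "rim (a # xs) 0 = 0"
| "rim (a # xs) (Suc c) = of_bool (a = c) + rim xs c"

lemma rim_0 [simp]: "rim xs 0 = 0"
  by (cases xs) auto

lemma part_Cons_Suc: "1 \<le> i \<Longrightarrow> part (a # xs) (Suc i) = part xs i"
  by (auto simp: part_def nth_Cons')

lemma part_Cons_1: "part (a # xs) (Suc 0) = a"
  by (auto simp: part_def)

lemma part_le: "(\<And>x. x \<in> set xs \<Longrightarrow> x \<le> a) \<Longrightarrow> part xs i \<le> a"
  by (auto simp: part_def)

lemma conj_part_Nil [simp]: "conj_part [] j = 0"
  by (simp add: conj_part_def)

lemma conj_part_Cons: "conj_part (a # xs) j = of_bool (j \<le> a) + conj_part xs j"
proof -
  let ?A = "{i. 1 \<le> i \<and> i \<le> length xs \<and> j \<le> part xs i}"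
  have "{i. 1 \<le> i \<and> i \<le> length (a # xs) \<and> j \<le> part (a # xs) i}
      = (if j \<le> a then {1} else {}) \<union> Suc ` ?A" (is "?L = ?R")
  proof (intro set_eqI)
    fix i show "i \<in> ?L \<longleftrightarrow> i \<in> ?R"
    proof (cases "i \<le> 1")
      case True
      then have "i = 0 \<or> i = 1" by auto
      then show ?thesis by (auto simp: part_Cons_1)
    next
      case False
      then obtain i' where "i = Suc i'" "1 \<le> i'"
        by (cases i) auto
      then show ?thesis by (auto simp: part_Cons_Suc)
    qed
  qed
  moreover have "finite ?A" by auto
  moreover have "card (Suc ` ?A) = card ?A" by (simp add: card_image)
  moreover have "1 \<notin> Suc ` ?A" by auto
  ultimately show ?thesis by (simp add: conj_part_def)
qed

lemma conj_part_eq_0: "(\<And>x. x \<in> set xs \<Longrightarrow> x < j) \<Longrightarrow> conj_part xs j = 0"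
  by (induction xs) (auto simp: conj_part_Cons not_le)

text \<open>Prepending a row \<open>a\<close> lengthens exactly the columns \<open>j \<le> a\<close>
  by one, so these contribute to \<open>c\<close> what they contributed to \<open>c - 1\<close>. The
  columns \<open>j > a\<close> are empty and contribute only \<open>j = c\<close>.\<close>

lemma card_conj_part_eq_rim:
  "sorted_wrt (\<ge>) xs \<Longrightarrow> card {j. 1 \<le> j \<and> conj_part xs j + j = c} = rim xs c"
proof (induction xs arbitrary: c)
  case Nil
  have "{j. 1 \<le> j \<and> conj_part [] j + j = c} = (if 0 < c then {c} else {})" by auto
  then show ?case by simp
next
  case (Cons a xs)
  have le: "\<And>x. x \<in> set xs \<Longrightarrow> x \<le> a" using Cons.prems by auto
  have zero: "conj_part xs j = 0" if "a < j" for j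
    using le that by (intro conj_part_eq_0) (meson le_less_trans)
  show ?case
  proof (cases c)
    case 0
    then have "{j. 1 \<le> j \<and> conj_part (a # xs) j + j = c} = {}" by auto
    then show ?thesis using 0 by (simp del: One_nat_def)
  next
    case (Suc d)
    let ?B = "{j. 1 \<le> j \<and> j \<le> a \<and> conj_part xs j + j = d}"
    have fin: "finite ?B" by (rule finite_subset[of _ "{..a}"]) auto
    have "{j. 1 \<le> j \<and> conj_part (a # xs) j + j = c} = ?B \<union> (if a < c then {c} else {})"
    proof (intro set_eqI)
      fix j
      show "j \<in> {j. 1 \<le> j \<and> conj_part (a # xs) j + j = c} \<longleftrightarrow>
          j \<in> ?B \<union> (if a < c then {c} else {})"
        using Suc by (cases "a < j") (auto simp: conj_part_Cons zero)
    qed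
    then have 1: "card {j. 1 \<le> j \<and> conj_part (a # xs) j + j = c} = card ?B + of_bool (a < c)"
      using fin by auto
    have "{j. 1 \<le> j \<and> conj_part xs j + j = d} = ?B \<union> (if a < d then {d} else {})"
    proof (intro set_eqI)
      fix j
      show "j \<in> {j. 1 \<le> j \<and> conj_part xs j + j = d} \<longleftrightarrow>
          j \<in> ?B \<union> (if a < d then {d} else {})"
        by (cases "a < j") (auto simp: zero)
    qed
    then have 2: "card {j. 1 \<le> j \<and> conj_part xs j + j = d} = card ?B + of_bool (a < d)"
      using fin by auto
    have "card {j. 1 \<le> j \<and> conj_part xs j + j = d} = rim xs d"
      using Cons by auto
    with 1 2 Suc show ?thesis by auto
  qed
qed

lemma dinv_Nil [simp]: "dinv [] = 0"
proof -
  have "diagram [] = {}" by (auto simp: diagram_def)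
  then show ?thesis by (simp add: dinv_def)
qed

text \<open>A cell \<open>(1, j)\<close> of the new row has arm minus leg equal to
  \<open>a - j - conj_part xs j\<close>, so it counts iff \<open>conj_part xs j + j\<close> is
  \<open>a\<close> or \<open>a - 1\<close>. The cells of the other rows keep their arms and
  legs.\<close>

lemma dinv_Cons:
  assumes "sorted_wrt (\<ge>) (a # xs)"
  shows "dinv (a # xs) = dinv xs + rim xs a + rim xs (a - 1)"
proof -
  let ?good = "\<lambda>ys. {c \<in> diagram ys. arm ys c - leg ys c \<in> {0, 1}}"
  let ?U = "\<lambda>c. {j. 1 \<le> j \<and> conj_part xs j + j = c}"
  let ?f = "\<lambda>(i, j). (Suc i, j) :: nat \<times> nat"
  have le: "part xs i \<le> a" for i
    using assms by (intro part_le) auto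
  have eq: "?good (a # xs) = Pair 1 ` (?U a \<union> ?U (a - 1)) \<union> ?f ` ?good xs" (is "?L = ?R")
  proof (intro set_eqI)
    fix c :: "nat \<times> nat"
    obtain i j where c: "c = (i, j)" by (cases c)
    show "c \<in> ?L \<longleftrightarrow> c \<in> ?R"
    proof (cases "i \<le> 1")
      case True
      then consider "i = 0" | "i = 1" by linarith
      then show ?thesis
      proof cases
        case 1
        then show ?thesis using c by (auto simp: diagram_def)
      next
        case 2
        have "c \<in> ?R \<longleftrightarrow> 1 \<le> j \<and> (conj_part xs j + j = a \<or> conj_part xs j + j = a - 1)"
          using c 2 by (auto simp: diagram_def)
        moreover have "c \<in> ?L \<longleftrightarrow> 1 \<le> j \<and> j \<le> a \<and>
            int a - int j - int (conj_part xs j) \<in> {0, 1}"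
          using c 2 by (auto simp: diagram_def arm_def leg_def part_Cons_1 conj_part_Cons)
        moreover have "1 \<le> j \<and> j \<le> a \<and> int a - int j - int (conj_part xs j) \<in> {0, 1} \<longleftrightarrow>
            1 \<le> j \<and> (conj_part xs j + j = a \<or> conj_part xs j + j = a - 1)"
          unfolding insert_iff empty_iff by arith
        ultimately show ?thesis by simp
      qed
    next
      case False
      then obtain i' where i: "i = Suc i'" "1 \<le> i'"
        by (cases i) auto
      have R: "c \<in> ?R \<longleftrightarrow> (i', j) \<in> ?good xs"
        using c i by auto
      have "(i, j) \<in> diagram (a # xs) \<longleftrightarrow> (i', j) \<in> diagram xs"
        using i by (auto simp: diagram_def part_Cons_Suc)
      moreover have "arm (a # xs) (i, j) = arm xs (i', j)"
        using i by (simp add: arm_def part_Cons_Suc)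
      moreover have "leg (a # xs) (i, j) = leg xs (i', j)" if "(i', j) \<in> diagram xs"
        using i that le[of i'] by (auto simp: leg_def conj_part_Cons diagram_def)
      ultimately show ?thesis unfolding R unfolding c by auto
    qed
  qed
  have fin: "finite (?U c)" for c
    by (rule finite_subset[of _ "{..c}"]) auto
  have "?good xs \<subseteq> {..length xs} \<times> {..a}"
    using le by (auto simp: diagram_def intro: order_trans)
  then have fing: "finite (?good xs)"
    by (rule finite_subset) auto
  have inj: "inj_on ?f A" for A
    by (auto simp: inj_on_def)
  have disj: "Pair 1 ` (?U a \<union> ?U (a - 1)) \<inter> ?f ` ?good xs = {}"
    by (auto simp: diagram_def)
  have "dinv (a # xs) = card (?U a \<union> ?U (a - 1)) + dinv xs"
  proof -
    have "dinv (a # xs) = card (Pair (1::nat) ` (?U a \<union> ?U (a - 1))) + card (?f ` ?good xs)"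
      unfolding dinv_def eq using fin fing disj by (intro card_Un_disjoint) auto
    also have "card (?f ` ?good xs) = dinv xs"
      unfolding dinv_def by (rule card_image[OF inj])
    also have "card (Pair (1::nat) ` (?U a \<union> ?U (a - 1))) = card (?U a \<union> ?U (a - 1))"
      by (rule card_image) (auto simp: inj_on_def)
    finally show ?thesis .
  qed
  moreover have "card (?U a \<union> ?U (a - 1)) = card (?U a) + card (?U (a - 1))"
  proof (cases a)
    \<comment> \<open>Truncated subtraction makes \<open>a - 1 = a\<close>; the two sets coincide,
      but both are empty because \<open>j \<ge> 1\<close>.\<close>
    case 0
    then have "?U a = {}" "?U (a - 1) = {}" by auto
    then show ?thesis by (simp only: Un_empty_left card.empty)
  next
    case (Suc b)
    then show ?thesis using fin by (intro card_Un_disjoint) auto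
  qed
  moreover have "card (?U c) = rim xs c" for c
    using assms by (intro card_conj_part_eq_rim) simp
  ultimately show ?thesis by simp
qed

text \<open>Every row up to the length shifts its sum by one. The empty rows do not: they count for
  \<open>c > length xs\<close> on the left and for \<open>c \<ge> length xs\<close> on the right,
  hence the correction.\<close>

lemma rim_map_pred:
  "0 \<notin> set xs \<Longrightarrow> rim (map (\<lambda>x. x - 1) xs) c + of_bool (c = length xs) = rim xs (Suc c)"
proof (induction xs arbitrary: c)
  case (Cons b xs)
  have IH: "rim (map (\<lambda>x. x - 1) xs) d + of_bool (d = length xs) = rim xs (Suc d)" for d
    using Cons by simp
  from Cons.prems have "0 < b" by simp
  then show ?case
    using IH[of "c - 1"] by (cases c) auto
qed auto

lemma sorted_wrt_map_pred:
  "sorted_wrt (\<ge>) xs \<Longrightarrow> sorted_wrt (\<ge>) (map (\<lambda>x. x - 1 :: nat) xs)"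
  by (induction xs) auto

text \<open>Here \<open>dinv\<close> is computed by removing the first column instead of the first row.\<close>

lemma dinv_map_pred:
  "is_partition xs \<Longrightarrow> dinv xs + 2 =
     dinv (map (\<lambda>x. x - 1) xs) + rim xs (Suc (length xs)) + rim xs (length xs + 2)"
proof (induction xs)
  \<comment> \<open>The summand 2 in the claim offsets the first two empty rows, which
    \<open>rim\<close> counts although they have no cell in the first column.\<close>
  case (Cons a xs)
  then have p: "is_partition xs" "0 \<notin> set xs" "0 < a" "sorted_wrt (\<ge>) (a # xs)"
    by (auto simp: is_partition_def)
  obtain b where a: "a = Suc b" using p(3) by (cases a) auto
  have s: "sorted_wrt (\<ge>) (b # map (\<lambda>x. x - 1) xs)"
    using sorted_wrt_map_pred[OF p(4)] a by simp
  have 1: "rim (map (\<lambda>x. x - 1) xs) b + of_bool (b = length xs) = rim xs (Suc b)"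
    by (rule rim_map_pred[OF p(2)])
  have 2: "rim (map (\<lambda>x. x - 1) xs) (b - 1) + of_bool (b = Suc (length xs)) = rim xs b"
    using rim_map_pred[OF p(2), of "b - 1"] by (cases b) auto
  show ?case
    using Cons.IH[OF p(1)] 1 2 dinv_Cons[OF p(4)] dinv_Cons[OF s] a
    by (simp add: numeral_2_eq_2)
qed simp

text \<open>Zeros of a sorted list are trailing, and \<open>rim\<close> treats them like rows beyond
  the length.\<close>

lemma rim_filter_pos: "sorted_wrt (\<ge>) xs \<Longrightarrow> rim (filter (\<lambda>x. x > 0) xs) c = rim xs c"
proof (induction xs arbitrary: c)
  case (Cons a xs)
  show ?case
  proof (cases "a = 0")
    case True
    then have *: "filter (\<lambda>x. x > 0) xs = []" using Cons.prems by (auto simp: filter_empty_conv)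
    have "rim xs d = of_bool (0 < d)" for d
      using Cons.IH[of d] Cons.prems * by simp
    then show ?thesis using True * by (cases c) auto
  next
    case False
    then show ?thesis using Cons by (cases c) auto
  qed
qed simp

lemma sorted_wrt_filter_pos: "sorted_wrt (\<ge>) xs \<Longrightarrow> sorted_wrt (\<ge>) (filter (\<lambda>x. x > (0::nat)) xs)"
  by (rule sorted_wrt_filter)

lemma dinv_filter_pos: "sorted_wrt (\<ge>) xs \<Longrightarrow> dinv (filter (\<lambda>x. x > 0) xs) = dinv xs"
proof (induction xs)
  case (Cons a xs)
  have s: "sorted_wrt (\<ge>) (a # filter (\<lambda>x. x > 0) xs)"
    using Cons.prems sorted_wrt_filter_pos[of xs] by auto
  show ?case
    using Cons dinv_Cons[OF Cons.prems] dinv_Cons[OF s] by (auto simp: rim_filter_pos)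
qed simp

section \<open>The map \<open>nu\<close>: size, \<open>dinv\<close>, length and
  multiplicities\<close>

abbreviation shrink :: "nat list \<Rightarrow> nat list" where
  "shrink xs \<equiv> filter (\<lambda>x. x > 0) (map (\<lambda>x. x - 1) xs)"

lemma nu_eq: "part xs 1 \<le> length xs + 2 \<Longrightarrow> nu xs = (length xs + 1) # shrink xs"
  by (simp add: nu_def)

lemma part_1: "part xs (Suc 0) = (case xs of [] \<Rightarrow> 0 | a # _ \<Rightarrow> a)"
  by (auto simp: part_def split: list.splits)

lemma sorted_wrt_nu:
  assumes "is_partition xs" "part xs 1 \<le> length xs + 2"
  shows "sorted_wrt (\<ge>) ((length xs + 1) # map (\<lambda>x. x - 1) xs)"
  using assms sorted_wrt_map_pred[of xs]
  by (cases xs) (auto simp: is_partition_def part_1)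

lemma is_partition_nu:
  assumes "is_partition xs" "part xs 1 \<le> length xs + 2"
  shows "is_partition (nu xs)"
  using sorted_wrt_filter_pos[OF sorted_wrt_nu[OF assms]] assms
  by (auto simp: nu_eq is_partition_def)

text \<open>The loss from deleting the first column and the gain from the new row involve the same
  two values of \<open>rim\<close>. What remains is the 2 of \<open>dinv_map_pred\<close> minus the
  correction 1 of \<open>rim_map_pred\<close> at \<open>c = length xs\<close>.\<close>

lemma dinv_nu:
  assumes "is_partition xs" "part xs 1 \<le> length xs + 2"
  shows "dinv (nu xs) = Suc (dinv xs)"
proof -
  let ?ys = "map (\<lambda>x. x - 1) xs"
  have nz: "0 \<notin> set xs" using assms(1) by (auto simp: is_partition_def)
  have "nu xs = filter (\<lambda>x. x > 0) ((length xs + 1) # ?ys)"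
    using assms(2) by (simp add: nu_def)
  then have "dinv (nu xs) = dinv ((length xs + 1) # ?ys)"
    using dinv_filter_pos[OF sorted_wrt_nu[OF assms]] by simp
  also have "\<dots> = dinv ?ys + rim ?ys (length xs + 1) + rim ?ys (length xs)"
    using dinv_Cons[OF sorted_wrt_nu[OF assms]] by simp
  finally show ?thesis
    using dinv_map_pred[OF assms(1)] rim_map_pred[OF nz, of "length xs"]
      rim_map_pred[OF nz, of "length xs + 1"] by simp
qed

lemma sum_list_nu:
  assumes "is_partition xs" "part xs 1 \<le> length xs + 2"
  shows "sum_list (nu xs) = Suc (sum_list xs)"
proof -
  have "0 \<notin> set ys \<Longrightarrow> sum_list (shrink ys) + length ys = sum_list ys" for ys
    by (induction ys) auto
  from this[of xs] assms show ?thesis by (simp add: nu_eq is_partition_def)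
qed

text \<open>Exactly the parts 1 vanish. With \<open>count_list_shrink\<close>, the lengths of
  iterates of \<open>nu\<close> can be read off the multiplicities in the initial partition.\<close>

lemma length_shrink:
  "0 \<notin> set xs \<Longrightarrow> length (shrink xs) + count_list xs 1 = length xs"
  by (induction xs) auto

lemma count_list_shrink: "0 < t \<Longrightarrow> count_list (shrink xs) t = count_list xs (Suc t)"
  by (induction xs) auto

section \<open>Containment in the staircase\<close>

text \<open>A form of staircase containment for lists without zeros, suited to recursion: dropping
  the first row lowers \<open>n\<close> by one.\<close>

definition fits :: "nat \<Rightarrow> nat list \<Rightarrow> bool" where
  "fits n xs \<longleftrightarrow> (\<forall>i<length xs. xs ! i + i < n)"

lemma fits_Nil [simp]: "fits n []"
  by (simp add: fits_def)

lemma fits_Cons: "fits n (a # xs) \<longleftrightarrow> a < n \<and> fits (n - 1) xs"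
  by (auto simp: fits_def All_less_Suc2 less_diff_conv)

lemma fits_append: "fits n (xs @ ys) \<longleftrightarrow> fits n xs \<and> fits (n - length xs) ys"
  by (induction xs arbitrary: n) (auto simp: fits_Cons)

lemma fits_replicate: "fits n (replicate m a) \<longleftrightarrow> m = 0 \<or> a + m \<le> n"
proof (induction m arbitrary: n)
  case (Suc m)
  have "fits n (replicate (Suc m) a) \<longleftrightarrow> a < n \<and> (m = 0 \<or> a + m \<le> n - 1)"
    by (simp add: fits_Cons Suc.IH)
  also have "\<dots> \<longleftrightarrow> a + Suc m \<le> n" by arith
  finally show ?case by simp
qed simp

text \<open>Rows of length 1 vanish and impose nothing on the left; the bound on
  \<open>length xs\<close> supplies their condition on the right.\<close>

lemma fits_shrink:
  "is_partition xs \<Longrightarrow> length xs \<le> n \<Longrightarrow> fits n (shrink xs) \<longleftrightarrow> fits (Suc n) xs"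
proof (induction xs arbitrary: n)
  case (Cons a xs)
  then have p: "is_partition xs" "a \<noteq> 0" "length xs \<le> n - 1" "n \<noteq> 0" "\<And>x. x \<in> set xs \<Longrightarrow> x \<le> a"
    by (auto simp: is_partition_def)
  have IH: "fits (n - 1) (shrink xs) \<longleftrightarrow> fits n xs"
    using Cons.IH[OF p(1,3)] p(4) by simp
  show ?case
  proof (cases "a = 1")
    case True
    then have e: "shrink xs = []" using p(5) by (auto simp: filter_empty_conv)
    show ?thesis using IH e True p(4) by (simp add: fits_Cons)
  next
    case False
    with p(2) IH show ?thesis by (auto simp: fits_Cons)
  qed
qed simp

text \<open>The old cells move one row down and one column left, staying on their antidiagonals;
  only the new first row adds a condition.\<close>

lemma fits_nu:
  assumes "is_partition xs" "part xs 1 \<le> length xs + 2"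
  shows "fits n (nu xs) \<longleftrightarrow> fits n xs \<and> length xs + 2 \<le> n"
  using fits_shrink[OF assms(1), of "n - 1"] assms(2)
  by (cases n) (auto simp: nu_eq fits_Cons)

lemma DP_iff_fits: "xs \<in> DP n \<longleftrightarrow> is_partition xs \<and> fits n xs"
proof -
  have part_stair: "part (rev [1..<n]) i = (if 1 \<le> i \<and> i < n then n - i else 0)" for i
    by (auto simp: part_def rev_nth)
  have d: "diagram (rev [1..<n]) = {(i, j). 1 \<le> i \<and> 1 \<le> j \<and> i + j \<le> n}"
    unfolding diagram_def part_stair by (auto split: if_splits)
  have "diagram xs \<subseteq> diagram (rev [1..<n]) \<longleftrightarrow> fits n xs" if nz: "0 \<notin> set xs"
  proof
    assume *: "diagram xs \<subseteq> diagram (rev [1..<n])"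
    show "fits n xs" unfolding fits_def
    proof (intro allI impI)
      fix i assume i: "i < length xs"
      then have "xs ! i \<noteq> 0" using nz by (metis nth_mem)
      then have "(Suc i, xs ! i) \<in> diagram xs" using i by (auto simp: diagram_def part_def)
      with * d show "xs ! i + i < n" by auto
    qed
  next
    assume *: "fits n xs"
    show "diagram xs \<subseteq> diagram (rev [1..<n])"
    proof
      fix c assume c: "c \<in> diagram xs"
      obtain i j where ij: "c = (i, j)" by (cases c)
      with c have "1 \<le> i" "i \<le> length xs" "1 \<le> j" "j \<le> xs ! (i - 1)"
        by (auto simp: diagram_def part_def)
      moreover from this have "i - 1 < length xs" by simp
      then have "xs ! (i - 1) + (i - 1) < n" using * unfolding fits_def by blast
      ultimately show "c \<in> diagram (rev [1..<n])" unfolding d ij by auto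
    qed
  qed
  then show ?thesis by (auto simp: DP_def is_partition_def)
qed


section \<open>Staircases with a gap and the partitions \<open>II k l\<close>\<close>

text \<open>
  \<open>(s+t+1, \<dots>, s+2, s, \<dots>, 1)\<close>, the staircase with the part \<open>s+1\<close> left out. Below its \<open>1 + \<lfloor>k/l\<rfloor>\<close> rows
  of length \<open>l\<close>, \<open>I\<^sub>k\<^sub>,\<^sub>l\<close> is such a partition with \<open>t = r\<^sub>k\<^sub>,\<^sub>l\<close> and \<open>s + t + 1 = l\<close>.
\<close>

definition gap :: "nat \<Rightarrow> nat \<Rightarrow> nat list" where
  "gap s t = rev [s + 2..<s + 2 + t] @ rev [1..<Suc s]"

lemma gap_0_0 [simp]: "gap 0 0 = []"
  by (simp add: gap_def)

lemma gap_Suc_0 [simp]: "gap (Suc s) 0 = Suc s # gap s 0"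
  by (simp add: gap_def)

lemma gap_Suc [simp]: "gap s (Suc t) = (s + t + 2) # gap s t"
  by (simp add: gap_def)

lemma length_gap [simp]: "length (gap s t) = s + t"
  unfolding gap_def length_append length_rev length_upt by simp

lemma gap_induct:
  assumes "P 0 0" "\<And>s. P s 0 \<Longrightarrow> P (Suc s) 0" "\<And>s t. P s t \<Longrightarrow> P s (Suc t)"
  shows "P s t"
proof (induction t)
  case 0
  show ?case by (induction s) (auto intro: assms)
qed (auto intro: assms)

text \<open>The \<open>t\<close> rows above the gap have sum \<open>s + t + 2\<close>, the
  \<open>s\<close> rows below it have sum \<open>s + t + 1\<close>, and the empty rows give every
  \<open>c > s + t\<close> once.\<close>

lemma rim_gap:
  "rim (gap s t) c = of_bool (s + t < c) + (if c = s + t + 1 then s else 0) +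
     (if c = s + t + 2 then t else 0)"
proof (induction s t arbitrary: c rule: gap_induct)
  case (2 s)
  then show ?case by (cases c) auto
next
  case (3 s t)
  then show ?case by (cases c) auto
qed auto

lemma set_gap: "x \<in> set (gap s t) \<Longrightarrow> 0 < x \<and> x \<le> s + (if t = 0 then 0 else t + 1)"
  by (auto simp: gap_def)

lemma sorted_wrt_gap: "sorted_wrt (\<ge>) (gap s t)"
  by (induction s t rule: gap_induct) (auto dest: set_gap split: if_splits)

text \<open>Every cell counts: by \<open>rim_gap\<close>, each row added in the induction raises
  \<open>dinv\<close> by its full length.\<close>

lemma dinv_gap: "dinv (gap s t) = sum_list (gap s t)"
proof (induction s t rule: gap_induct)
  case (2 s)
  then show ?case using dinv_Cons[of "Suc s" "gap s 0"] sorted_wrt_gap[of "Suc s" 0]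
    by (simp add: rim_gap)
next
  case (3 s t)
  then show ?case using dinv_Cons[of "s + t + 2" "gap s t"] sorted_wrt_gap[of s "Suc t"]
    by (simp add: rim_gap)
qed auto

definition tri :: "nat \<Rightarrow> nat" where
  "tri l = Suc l choose 2"

lemma tri_0 [simp]: "tri 0 = 0"
  by (simp add: tri_def)

lemma tri_Suc [simp]: "tri (Suc l) = tri l + Suc l"
  by (simp add: tri_def numeral_2_eq_2)

lemma sum_list_gap: "sum_list (gap s t) + Suc s = tri (s + t + 1)"
  by (induction s t rule: gap_induct) auto

lemma count_list_gap: "count_list (gap s t) c = of_bool (1 \<le> c \<and> c \<le> s + t + 1 \<and> c \<noteq> s + 1)"
  by (induction s t rule: gap_induct) auto

lemma fits_gap: "fits n (gap s t) \<longleftrightarrow> s + t = 0 \<or> s + t + 1 + of_bool (0 < t) \<le> n"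
proof (induction s t arbitrary: n rule: gap_induct)
  case (2 s)
  have "fits n (gap (Suc s) 0) \<longleftrightarrow> Suc s < n \<and> (s = 0 \<or> s + 1 \<le> n - 1)"
    by (simp add: fits_Cons 2)
  also have "\<dots> \<longleftrightarrow> s + 2 \<le> n" by arith
  finally show ?case by simp
next
  case (3 s t)
  have "fits n (gap s (Suc t)) \<longleftrightarrow>
      s + t + 2 < n \<and> (s + t = 0 \<or> s + t + 1 + of_bool (0 < t) \<le> n - 1)"
    by (simp add: fits_Cons 3)
  also have "\<dots> \<longleftrightarrow> Suc (Suc (Suc (s + t))) \<le> n" by (cases "t = 0") (simp_all, arith+)
  finally show ?case by simp
qed auto

lemma II_eq:
  assumes "0 < l"
  shows "II k l = replicate (Suc (k div l)) l @ gap (l - 1 - k mod l) (k mod l)"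
proof -
  define q t s where "q = Suc (k div l)" and "t = k mod l" and "s = l - 1 - t"
  have "t < l" using assms by (simp add: t_def)
  then have l: "l = Suc s + t" by (simp add: s_def)
  \<comment> \<open>The staircase is split after its \<open>t\<close> largest parts, the ones raised
    by 1.\<close>
  have "[1..<l] = [1..<Suc s] @ [Suc s..<Suc s + t]"
    unfolding l by (rule upt_add_eq_append) simp
  then have rev: "rev [1..<l] = rev [Suc s..<Suc s + t] @ rev [1..<Suc s]" by simp
  have 1: "map2 (+) (replicate q l) (replicate q 0) = replicate q l"
    by simp
  have 2: "map2 (+) (rev [Suc s..<Suc s + t]) (replicate t 1) = rev [s + 2..<s + 2 + t]"
    by (induction t) auto
  have 3: "map2 (+) (rev [1..<Suc s]) (replicate s 0) = rev [1..<Suc s]"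
    by (induction s) auto
  have "II k l = map2 (+) (replicate q l @ rev [1..<l])
      (replicate q 0 @ replicate t 1 @ replicate s 0)"
    using assms by (simp add: II_def q_def t_def s_def)
  also have "\<dots> = map2 (+) (replicate q l) (replicate q 0) @
      map2 (+) (rev [Suc s..<Suc s + t]) (replicate t 1) @
      map2 (+) (rev [1..<Suc s]) (replicate s 0)"
    unfolding rev by (simp del: upt_Suc)
  also have "\<dots> = replicate q l @ gap s t"
    unfolding 1 2 3 gap_def by simp
  finally show ?thesis unfolding q_def s_def t_def .
qed

lemma rim_replicate_gap:
  "c \<le> s + t \<Longrightarrow> rim (replicate j (s + t + 1) @ gap s t) c = 0"
proof (induction j arbitrary: c)
  case 0
  then show ?case by (simp add: rim_gap)
next
  case (Suc j)
  then show ?case by (cases c) auto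
qed

lemma rim_replicate_gap_eq_0:
  "rim (replicate (Suc j) (s + t + 1) @ gap s t) (s + t + 1) = 0"
  using rim_replicate_gap[of "s + t" s t j] by simp

lemma sorted_wrt_replicate_gap: "sorted_wrt (\<ge>) (replicate j (s + t + 1) @ gap s t)"
  by (induction j) (auto simp: sorted_wrt_gap dest!: set_gap split: if_splits)

text \<open>The lowest long row adds \<open>s + 1\<close>, which is just the part missing from the
  staircase. Each further long row adds nothing, since \<open>rim\<close> vanishes at both relevant
  places.\<close>

lemma dinv_replicate_gap: "dinv (replicate (Suc j) (s + t + 1) @ gap s t) = tri (s + t + 1)"
proof (induction j)
  case 0
  show ?case
    using dinv_Cons[of "s + t + 1" "gap s t"] sorted_wrt_replicate_gap[of 1 s t] sum_list_gap[of s t]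
    by (simp add: rim_gap dinv_gap)
next
  case (Suc j)
  let ?xs = "replicate (Suc j) (s + t + 1) @ gap s t"
  have "sorted_wrt (\<ge>) ((s + t + 1) # ?xs)"
    using sorted_wrt_replicate_gap[of "Suc (Suc j)" s t] by simp
  from dinv_Cons[OF this] Suc show ?case
    using rim_replicate_gap[of "s + t" s t "Suc j"] rim_replicate_gap_eq_0[of j s t] by simp
qed

section \<open>Iterating \<open>nu\<close> on \<open>II k l\<close>, with
  \<open>k = q * l + r\<close>\<close>

context
  fixes k l q r :: nat
  assumes l_pos: "0 < l" and q: "q = k div l" and r: "r = k mod l"
begin

lemma r_less: "r < l"
  using l_pos r by simp

lemma k_eq: "k = q * l + r"
  using q r by simp

lemma II_gap: "II k l = replicate (Suc q) ((l - 1 - r) + r + 1) @ gap (l - 1 - r) r"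
  using II_eq[OF l_pos, of k] r_less q r by simp

lemma is_partition_II: "is_partition (II k l)"
  unfolding II_gap is_partition_def
  by (intro conjI sorted_wrt_replicate_gap) (auto dest: set_gap)

lemma dinv_II: "dinv (II k l) = tri l"
  unfolding II_gap dinv_replicate_gap using r_less by simp

lemma sum_list_II: "sum_list (II k l) = k + tri l"
  using sum_list_gap[of "l - 1 - r" r] r_less k_eq unfolding II_gap
  by (simp add: sum_list_replicate)

lemma length_II: "length (II k l) = l + q"
  using r_less unfolding II_gap by simp

lemma count_list_II: "1 \<le> c \<Longrightarrow> c < l \<Longrightarrow> count_list (II k l) c = of_bool (c \<noteq> l - r)"
proof -
  have *: "x \<noteq> c \<Longrightarrow> count_list (replicate j x) c = 0" for j x c :: nat
    by (induction j) auto
  show "1 \<le> c \<Longrightarrow> c < l \<Longrightarrow> count_list (II k l) c = of_bool (c \<noteq> l - r)"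
    using r_less unfolding II_gap count_list_append count_list_gap by (subst *) auto
qed

lemma fits_II: "fits n (II k l) \<longleftrightarrow> l + q + 1 + of_bool (0 < r) \<le> n"
proof -
  have e: "(l - 1 - r) + r = l - 1" using r_less by simp
  have "fits n (II k l) \<longleftrightarrow>
      l + Suc q \<le> n \<and> (l - 1 = 0 \<or> l + of_bool (0 < r) \<le> n - Suc q)"
    unfolding II_gap fits_append fits_replicate fits_gap length_replicate e using l_pos by simp
  also have "\<dots> \<longleftrightarrow> l + q + 1 + of_bool (0 < r) \<le> n"
  proof (cases "r = 0")
    case True
    then show ?thesis by simp arith
  next
    case False
    with r_less have "l - 1 \<noteq> 0" by simp
    with False show ?thesis by simp arith
  qed
  finally show ?thesis .
qed

text \<open>The parts 1 of the \<open>m\<close>-th iterate come from the parts \<open>m + 1\<close>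
  of \<open>II k l\<close>. For \<open>m + 1 < l\<close> there is one such part, balancing the new
  row, except at the missing part \<open>l - r\<close>, where the length grows by one. This control
  ends at \<open>m = l\<close>, as the part \<open>l\<close> may be repeated.\<close>

lemma nu_iterate_II:
  assumes "m \<le> l"
  defines "x \<equiv> (nu ^^ m) (II k l)"
  shows "is_partition x \<and> sum_list x = k + tri l + m \<and> dinv x = tri l + m \<and>
    (m < l \<longrightarrow> length x = l + q + of_bool (l - r \<le> m) \<and> part x 1 \<le> length x + 2) \<and>
    (\<forall>c. 1 \<le> c \<and> c + m \<le> l \<longrightarrow> count_list x c = count_list (II k l) (c + m)) \<and>
    (\<forall>n. fits n x \<longleftrightarrow> fits n (II k l) \<and> (\<forall>j<m. l + q + of_bool (l - r \<le> j) + 2 \<le> n))"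
  using assms(1) unfolding x_def
proof (induction m)
  case 0
  have "part (II k l) 1 = l"
    using r_less unfolding II_gap by (simp add: part_1)
  then show ?case
    using is_partition_II sum_list_II dinv_II length_II r_less by simp
next
  case (Suc m)
  define x where "x = (nu ^^ m) (II k l)"
  have nu: "(nu ^^ Suc m) (II k l) = nu x" by (simp add: x_def)
  note IH = Suc.IH[folded x_def]
  have m: "m < l" "m \<le> l" using Suc.prems by auto
  have x: "is_partition x" "part x 1 \<le> length x + 2" "length x = l + q + of_bool (l - r \<le> m)"
    using IH m by auto
  have nz: "0 \<notin> set x" using x(1) by (simp add: is_partition_def)
  have eq: "nu x = (length x + 1) # shrink x" by (rule nu_eq[OF x(2)])
  have cnt: "count_list x 1 = count_list (II k l) (Suc m)"
    using IH m by auto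
  have len: "length (nu x) + count_list x 1 = length x + 1"
    using length_shrink[OF nz] eq by simp
  have "length (nu x) = l + q + of_bool (l - r \<le> Suc m) \<and> part (nu x) 1 \<le> length (nu x) + 2"
    if "Suc m < l"
  proof -
    have "count_list x 1 = of_bool (Suc m \<noteq> l - r)"
      using cnt count_list_II[of "Suc m"] that by simp
    with len x(3) have "length (nu x) = l + q + of_bool (l - r \<le> Suc m)"
      by (cases "Suc m = l - r"; cases "l - r \<le> m") auto
    moreover have "part (nu x) 1 = length x + 1" using eq by (simp add: part_1)
    ultimately show ?thesis using x(3) by auto
  qed
  moreover have "count_list (nu x) c = count_list (II k l) (c + Suc m)"
    if "1 \<le> c" "c + Suc m \<le> l" for c
  proof -
    \<comment> \<open>The new first part is at least \<open>l + 1\<close>, hence differs from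
      \<open>c\<close>.\<close>
    have "count_list (nu x) c = count_list (shrink x) c"
      using that x(3) eq by simp
    also have "\<dots> = count_list x (Suc c)"
      using that by (intro count_list_shrink) simp
    also have "\<dots> = count_list (II k l) (Suc c + m)"
      using IH m that by auto
    finally show ?thesis by simp
  qed
  moreover have "fits n (nu x) \<longleftrightarrow> fits n (II k l) \<and>
      (\<forall>j<Suc m. l + q + of_bool (l - r \<le> j) + 2 \<le> n)" for n
    using fits_nu[OF x(1,2), of n] IH m x(3) by (auto simp: less_Suc_eq)
  ultimately show ?case
    unfolding nu using is_partition_nu[OF x(1,2)] sum_list_nu[OF x(1,2)] dinv_nu[OF x(1,2)] IH m
    by auto
qed

lemma nu_iterate_II_DP:
  assumes "m \<le> l"
  shows "(nu ^^ m) (II k l) \<in> DP (Suc p) \<longleftrightarrow> l \<le> p \<and> k + m \<le> l * (p - l)"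
proof -
  \<comment> \<open>applied with \<open>c = \<lceil>y/l\<rceil>\<close>\<close>
  have threshold: "q * l + y \<le> l * w \<longleftrightarrow> q + c \<le> w"
    if "c * l < y + l" "y \<le> c * l" for y c w :: nat
  proof
    assume "q + c \<le> w"
    then have "(q + c) * l \<le> w * l" by (rule mult_le_mono1)
    with that show "q * l + y \<le> l * w" by (simp add: algebra_simps)
  next
    assume *: "q * l + y \<le> l * w"
    show "q + c \<le> w"
    proof (rule ccontr)
      assume "\<not> q + c \<le> w"
      then have "Suc w * l \<le> (q + c) * l" by (intro mult_le_mono1) simp
      with that * show False by (simp add: algebra_simps)
    qed
  qed
  have "(nu ^^ m) (II k l) \<in> DP (Suc p) \<longleftrightarrow>
      l + q + of_bool (0 < r) \<le> p \<and> (\<forall>j<m. l + q + of_bool (l - r \<le> j) + 1 \<le> p)"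
    using nu_iterate_II[OF assms] fits_II by (simp add: DP_iff_fits)
  also have "\<dots> \<longleftrightarrow> l \<le> p \<and> k + m \<le> l * (p - l)"
  proof (cases m)
    case 0
    have "q * l + r \<le> l * (p - l) \<longleftrightarrow> q + of_bool (0 < r) \<le> p - l"
      using r_less l_pos by (intro threshold) auto
    then show ?thesis using 0 k_eq by auto
  next
    case (Suc m')
    \<comment> \<open>As \<open>0 < r + m < 2 * l\<close>, the ceiling of \<open>(r + m) / l\<close>
      is 1 or 2, and it is 2 iff \<open>l - r \<le> m'\<close>.\<close>
    have "q * l + (r + m) \<le> l * (p - l) \<longleftrightarrow> q + (1 + of_bool (l - r \<le> m')) \<le> p - l"
      using r_less l_pos Suc assms by (intro threshold) auto
    \<comment> \<open>The bounds increase with \<open>j\<close>, so the last one,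
      \<open>j = m'\<close>, implies all others.\<close>
    moreover have "(l + q + of_bool (0 < r) \<le> p \<and> (\<forall>j<m. l + q + of_bool (l - r \<le> j) + 1 \<le> p))
        \<longleftrightarrow> l + q + of_bool (l - r \<le> m') + 1 \<le> p"
      using Suc by (force simp: less_Suc_eq)
    ultimately show ?thesis using k_eq by auto
  qed
  finally show ?thesis .
qed

end

section \<open>Triangular numbers\<close>

lemma tri_mono: "a \<le> b \<Longrightarrow> tri a \<le> tri b"
  by (induction b) (auto simp: le_Suc_eq)

lemma tri_add: "tri (a + b) = tri a + tri b + a * b"
  by (induction b) auto

text \<open>The intervals from \<open>tri l\<close> to \<open>tri l + l\<close> tile the naturals,
  since \<open>tri (l + 1) = tri l + l + 1\<close>.\<close>

lemma tri_decompose: "\<exists>l m. d = tri l + m \<and> m \<le> l"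
proof (induction d)
  case 0
  show ?case by (intro exI[of _ 0]) simp
next
  case (Suc d)
  then obtain l m where lm: "d = tri l + m" "m \<le> l" by blast
  show ?case
  proof (cases "m = l")
    case True
    then show ?thesis using lm by (intro exI[of _ "Suc l"] exI[of _ 0]) simp
  next
    case False
    then show ?thesis using lm by (intro exI[of _ l] exI[of _ "Suc m"]) simp
  qed
qed

lemma tri_le_tri_addD: "tri a \<le> tri b + m \<Longrightarrow> m \<le> b \<Longrightarrow> a \<le> b"
  using tri_mono[of "Suc b" a] by (cases "a \<le> b") auto

lemma tri_unique:
  assumes "tri a + m = tri b + n" "m \<le> a" "n \<le> b"
  shows "a = b" "m = n"
proof -
  show "a = b" using assms tri_le_tri_addD[of a b n] tri_le_tri_addD[of b a m] by simp
  with assms show "m = n" by simp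
qed

section \<open>Values of \<open>dinv\<close> on \<open>CC k\<close>, and the bijection\<close>

lemma CC_iff: "x \<in> CC k \<longleftrightarrow> (\<exists>l m. min 1 k \<le> l \<and> m \<le> l \<and> x = (nu ^^ m) (II k l))"
  by (auto simp: CC_def)

lemma CC_element:
  assumes "min 1 k \<le> l" "m \<le> l"
  defines "x \<equiv> (nu ^^ m) (II k l)"
  shows "sum_list x = k + tri l + m" "dinv x = tri l + m"
    "x \<in> DP (Suc p) \<longleftrightarrow> l \<le> p \<and> k + m \<le> l * (p - l)"
proof -
  have "sum_list x = k + tri l + m \<and> dinv x = tri l + m \<and>
    (x \<in> DP (Suc p) \<longleftrightarrow> l \<le> p \<and> k + m \<le> l * (p - l))"
  proof (cases "l = 0")
    case True
    then have "k = 0" "m = 0" "x = []" using assms by (auto simp: II_def)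
    then show ?thesis using True by (simp add: DP_iff_fits is_partition_def)
  next
    case False
    then show ?thesis
      using nu_iterate_II[of l "k div l" k "k mod l" m] assms
        nu_iterate_II_DP[of l "k div l" k "k mod l" m p] by simp
  qed
  then show "sum_list x = k + tri l + m" "dinv x = tri l + m"
    "x \<in> DP (Suc p) \<longleftrightarrow> l \<le> p \<and> k + m \<le> l * (p - l)" by auto
qed

lemma inj_on_dinv_CC: "inj_on dinv (CC k)"
proof (rule inj_onI)
  fix x y assume "x \<in> CC k" "y \<in> CC k" and eq: "dinv x = dinv y"
  then obtain l m l' m' where
    x: "min 1 k \<le> l" "m \<le> l" "x = (nu ^^ m) (II k l)" and
    y: "min 1 k \<le> l'" "m' \<le> l'" "y = (nu ^^ m') (II k l')"
    unfolding CC_iff by blast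
  have "tri l + m = tri l' + m'"
    using eq CC_element(2)[OF x(1,2)] CC_element(2)[OF y(1,2)] x(3) y(3) by simp
  from tri_unique[OF this x(2) y(2)] show "x = y" using x(3) y(3) by simp
qed

lemma sum_list_CC:
  assumes "x \<in> CC k"
  shows "sum_list x = k + dinv x"
  using assms CC_element(1,2) by (fastforce simp: CC_iff)

lemma CC_DP_partner:
  assumes "x \<in> CC k" "x \<in> DP (Suc p)"
  shows "\<exists>y \<in> CC k \<inter> DP (Suc p). k + dinv x + dinv y = tri p"
proof -
  obtain l m where x: "min 1 k \<le> l" "m \<le> l" "x = (nu ^^ m) (II k l)"
    using assms(1) unfolding CC_iff by blast
  have lp: "l \<le> p" "k + m \<le> l * (p - l)" and dx: "dinv x = tri l + m"
    using assms(2) CC_element[OF x(1,2)] x(3) by auto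
  have p: "tri p = tri l + tri (p - l) + l * (p - l)"
    using tri_add[of l "p - l"] lp(1) by simp
  \<comment> \<open>The value \<open>tri p - k - dinv x\<close> required of the partner, written so
    that \<open>tri (p - l) \<le> e\<close> is evident.\<close>
  define e where "e = tri (p - l) + (l * (p - l) - k - m)"
  have e: "k + dinv x + e = tri p"
    using p dx lp(2) by (simp add: e_def)
  obtain L M where LM: "e = tri L + M" "M \<le> L"
    using tri_decompose by blast
  have "tri (p - l) \<le> tri L + M"
    unfolding LM(1)[symmetric] e_def by simp
  from tri_le_tri_addD[OF this LM(2)] have "p - l \<le> L" .
  \<comment> \<open>By symmetry this gives \<open>tri (p - L) \<le> dinv x\<close>, the membership
    condition for the partner.\<close>
  then have "p - L \<le> l" by linarith
  then have "tri (p - L) \<le> dinv x"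
    using tri_mono[of "p - L" l] dx by simp
  moreover have "tri L \<le> tri p + 0" using e LM(1) by simp
  then have Lp: "L \<le> p" using tri_le_tri_addD[of L p 0] by simp
  have "tri p = tri L + tri (p - L) + L * (p - L)"
    using tri_add[of L "p - L"] Lp by simp
  ultimately have kM: "k + M \<le> L * (p - L)"
    using e LM(1) by simp
  then have minL: "min 1 k \<le> L" by (cases L) auto
  let ?y = "(nu ^^ M) (II k L)"
  have "?y \<in> CC k" using minL LM(2) unfolding CC_iff by blast
  moreover have "?y \<in> DP (Suc p)" "dinv ?y = e"
    using CC_element[OF minL LM(2)] Lp kM LM(1) by auto
  ultimately show ?thesis using e by blast
qed

text \<open>Injectivity of \<open>dinv\<close> leaves one choice of partner. The constant sum turns
  either required equation into the other, so taking partners is an involution and hence a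
  bijection.\<close>

lemma opposite_selfI:
  assumes sub: "A \<subseteq> DP n" and inj: "inj_on dinv A"
    and const: "\<And>x. x \<in> A \<Longrightarrow> area n x + int (dinv x) = N"
    and partner: "\<And>x. x \<in> A \<Longrightarrow> \<exists>y\<in>A. int (dinv y) = area n x"
  shows "opposite n A A"
proof -
  obtain h where h: "\<And>x. x \<in> A \<Longrightarrow> h x \<in> A" "\<And>x. x \<in> A \<Longrightarrow> int (dinv (h x)) = area n x"
    using partner by metis
  have area_h: "int (dinv x) = area n (h x)" if "x \<in> A" for x
    using const[OF that] const[OF h(1)[OF that]] h(2)[OF that] by simp
  have "h (h x) = x" if "x \<in> A" for x
    using that h area_h by (intro inj_onD[OF inj]) (auto simp flip: of_nat_eq_iff[where 'a = int])
  then have bij: "bij_betw (restrict h A) A A"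
    using h(1) by (intro bij_betw_byWitness[where f' = h]) auto
  have "\<exists>!g. g \<in> extensional A \<and> bij_betw g A A \<and>
      (\<forall>x\<in>A. area n x = int (dinv (g x)) \<and> int (dinv x) = area n (g x))"
  proof (rule ex1I[of _ "restrict h A"])
    show "restrict h A \<in> extensional A \<and> bij_betw (restrict h A) A A \<and>
      (\<forall>x\<in>A. area n x = int (dinv (restrict h A x)) \<and> int (dinv x) = area n (restrict h A x))"
      using bij h(2) area_h by auto
  next
    fix g assume g: "g \<in> extensional A \<and> bij_betw g A A \<and>
      (\<forall>x\<in>A. area n x = int (dinv (g x)) \<and> int (dinv x) = area n (g x))"
    show "g = restrict h A"
    proof (rule extensionalityI[of _ A])
      fix x assume x: "x \<in> A"
      then have "int (dinv (g x)) = int (dinv (h x))" "g x \<in> A"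
        using g h(2) by (auto simp: bij_betw_apply)
      then show "g x = restrict h A x"
        using x h(1) by (auto intro: inj_onD[OF inj])
    qed (use g in auto)
  qed
  with sub show ?thesis unfolding opposite_def by blast
qed

theorem theorem2p9:
  fixes k n :: nat
  shows "opposite n (CC k \<inter> DP n) (CC k \<inter> DP n)"
proof -
  have pos: "opposite (Suc p) (CC k \<inter> DP (Suc p)) (CC k \<inter> DP (Suc p))" for p
  proof (rule opposite_selfI)
    show "inj_on dinv (CC k \<inter> DP (Suc p))"
      by (rule inj_on_subset[OF inj_on_dinv_CC[of k]]) simp
    show "area (Suc p) x + int (dinv x) = int (tri p) - int k" if "x \<in> CC k \<inter> DP (Suc p)" for x
      using that sum_list_CC[of x k] by (simp add: area_def tri_def)
    show "\<exists>y\<in>CC k \<inter> DP (Suc p). int (dinv y) = area (Suc p) x" if x: "x \<in> CC k \<inter> DP (Suc p)" for x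
    proof -
      obtain y where y: "y \<in> CC k \<inter> DP (Suc p)" "k + dinv x + dinv y = tri p"
        using CC_DP_partner x by blast
      have "int (dinv y) = area (Suc p) x"
        using y(2) sum_list_CC[of x k] x unfolding area_def tri_def by simp
      with y(1) show ?thesis by blast
    qed
  qed simp
  show ?thesis
  proof (cases n)
    \<comment> \<open>Orders 0 and 1 share the empty staircase, and both binomials vanish.\<close>
    case 0
    have "DP 0 = DP 1" "area 0 = area 1"
      by (auto simp: DP_def area_def fun_eq_iff numeral_2_eq_2)
    then have "opposite 0 = opposite 1"
      by (simp add: opposite_def fun_eq_iff)
    with pos[of 0] 0 \<open>DP 0 = DP 1\<close> show ?thesis by simp
  qed (use pos in simp)
qed

end
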